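(* Let $p,q\ge 3$ be relatively prime odd integers, let $k_p,k_q$ be integers with $\gcd(k_p,p)=1$ and $\gcd(k_q,q)=1$, and let $c$ be a non-zero real number such that \[ c^2=-\frac{\cos\left(2\pi\left(\frac{k_p}{p}-\frac{k_q}{q}\right)\right)}{\cos\left(2\pi\left(\frac{k_p}{p}+\frac{k_q}{q}\right)\right)}. \] Let $a,b\in\mathbb{R}^4$ be \[ a=\begin{pmatrix}(1-c)\cos\frac{2\pi k_q}{q}\\ (1-c)\sin\frac{2\pi k_q}{q}\\ -(1+c)\sin\frac{2\pi k_q}{q}\\ (1-c)\cos\frac{2\pi k_q}{q}\end{pmatrix},\qquad b=\begin{pmatrix}c+1\\0\\0\\c-1\end{pmatrix}. \] Let $r$ be the unique integer in the interval $(0,pq)$ with $r\equiv 1\pmod p$ and $r\equiv -1\pmod q$, and let $M=R_{p,k_p}\otimes R_{q,k_q}$. Then: (i) For $0\le i<pq$ the set $B_i=\{M^ia,\ M^{i-1}a,\ M^ib,\ M^{i-r}b\}$ is an orthogonal basis of $\mathbb{R}^4$. (ii) Let $\mathcal{V}=\{M^ia: 0\le i<pq\}\cup\{M^ib:0\le i<pq\}$ and $\mathcal{B}=\{B_i:0\le i<pq\}$. Then $(\mathcal{V},\mathcal{B})$ is a Kochen-Specker pair in $\mathbb{R}^4$.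
   Context: For integers $m>0$ and $s\ge 0$, $R_{m,s}$ denotes the $2\times 2$ rotation matrix $\begin{pmatrix}\cos(2\pi s/m) & -\sin(2\pi s/m)\\ \sin(2\pi s/m) & \cos(2\pi s/m)\end{pmatrix}$. $\otimes$ denotes the Kronecker product of matrices. A pair $(\mathcal{V},\mathcal{B})$ is a Kochen-Specker pair in $\mathbb{C}^n$ (here applied with real vectors, $n=4$) if: (1) $\mathcal{V}$ is a finite set of vectors in $\mathbb{C}^n$; (2) $\mathcal{B}=(B_1,\dots,B_k)$ with $k$ odd, where each $B_i$ is an orthogonal basis of $\mathbb{C}^n$ with $B_i\subset\mathcal{V}$; (3) for each $v\in\mathcal{V}$, the number of indices $i$ with $v\in B_i$ is even.
   Formalization: The fourth entry of a is taken to be (1+c)cos(2πk_q/q) instead of the printed (1−c)cos(2πk_q/q); with the printed entry a is never orthogonal to Ma, so (i) fails for all admissible parameters. *)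

theory Defs
  imports
    "HOL-Number_Theory.Cong"
    "HOL-Analysis.Complex_Transcendental"
    "Jordan_Normal_Form.VS_Connect"
begin

definition rotation_mat :: "int \<Rightarrow> int \<Rightarrow> real mat" where
  "rotation_mat m s = mat_of_rows_list 2
     [[cos (2 * pi * of_int s / of_int m), - sin (2 * pi * of_int s / of_int m)],
      [sin (2 * pi * of_int s / of_int m),   cos (2 * pi * of_int s / of_int m)]]"

definition kronecker_product :: "'a::times mat \<Rightarrow> 'a mat \<Rightarrow> 'a mat" where
  "kronecker_product A B = mat (dim_row A * dim_row B) (dim_col A * dim_col B)
     (\<lambda>(i, j). A $$ (i div dim_row B, j div dim_col B) * B $$ (i mod dim_row B, j mod dim_col B))"

text \<open>Powers with possibly negative exponent, in the monoid of \<open>n \<times> n\<close> matrices;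
  meaningful for negative exponents only if \<open>A\<close> is invertible.\<close>

abbreviation mat_int_pow :: "nat \<Rightarrow> 'a::semiring_1 mat \<Rightarrow> int \<Rightarrow> 'a mat" where
  "mat_int_pow n A z \<equiv> A [^]\<^bsub>ring_mat TYPE('a) n ()\<^esub> z"

text \<open>The scalar product \<open>\<bullet>c\<close> conjugates its second argument. So the following notions are
  the Hermitian ones in \<open>\<complex>\<^sup>n\<close> for \<open>'a = complex\<close> and the Euclidean ones in \<open>\<real>\<^sup>n\<close> for
  \<open>'a = real\<close>.\<close>

definition orthogonal_basis :: "nat \<Rightarrow> 'a::conjugatable_field vec set \<Rightarrow> bool" where
  "orthogonal_basis n B \<longleftrightarrow>
     vectorspace.basis class_ring (module_vec TYPE('a) n) B \<and>
     (\<forall>u\<in>B. \<forall>v\<in>B. u \<noteq> v \<longrightarrow> u \<bullet>c v = 0)"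

definition kochen_specker_pair ::
    "nat \<Rightarrow> 'a::conjugatable_field vec set \<Rightarrow> 'a vec set list \<Rightarrow> bool" where
  "kochen_specker_pair n V Bs \<longleftrightarrow>
     finite V \<and> V \<subseteq> carrier_vec n \<and>
     odd (length Bs) \<and> (\<forall>B\<in>set Bs. orthogonal_basis n B \<and> B \<subseteq> V) \<and>
     (\<forall>v\<in>V. even (card {i. i < length Bs \<and> v \<in> Bs ! i}))"

text \<open>The last entry is \<open>(1 + c) cos \<phi>\<close>. The printed source has \<open>(1 - c) cos \<phi>\<close>, a sign error:
  with \<open>\<theta> = 2 \<pi> k\<^sub>p / p\<close>, \<open>\<phi> = 2 \<pi> k\<^sub>q / q\<close> and the required value of \<open>c\<^sup>2\<close>, that vector
  has scalar product \<open>2 (1 - c)\<^sup>2 (cos \<phi>)\<^sup>2 cos (\<theta> - \<phi>) \<noteq> 0\<close> with its image under \<open>M\<close>.\<close>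

definition vec_a :: "real \<Rightarrow> real \<Rightarrow> real vec" where
  "vec_a c \<phi> = vec_of_list
     [(1 - c) * cos \<phi>, (1 - c) * sin \<phi>, - (1 + c) * sin \<phi>, (1 + c) * cos \<phi>]"

definition vec_b :: "real \<Rightarrow> real vec" where
  "vec_b c = vec_of_list [c + 1, 0, 0, c - 1]"

end

theory Submission
  imports Defs
begin

text \<open>A vector of \<open>\<real>\<^sup>4\<close>, read as a \<open>2 \<times> 2\<close> matrix, is an \<open>\<real>\<close>-linear map
  \<open>z \<mapsto> \<alpha> z + \<beta> cnj z\<close> of \<open>\<complex>\<close>. In the coordinates \<open>(\<alpha>, \<beta>) \<in> \<complex>\<^sup>2\<close> the Kronecker product of the
  rotations by \<open>\<theta>\<close> and \<open>\<phi>\<close> is diagonal with entries \<open>cis (\<theta> - \<phi>)\<close> and \<open>cis (\<theta> + \<phi>)\<close>, while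
  \<open>a = (cis (- \<phi>), - c cis \<phi>)\<close> and \<open>b = (c, 1)\<close>. With \<open>\<theta>\<close>, \<open>\<phi>\<close> of coprime odd orders \<open>p\<close>, \<open>q\<close>
  modulo \<open>2 \<pi>\<close>, all scalar products in \<open>B\<^sub>i\<close> become cosine identities: the mixed ones vanish by
  the congruences defining \<open>r\<close>, the other two by the choice of \<open>c\<close>. Both orbits have exactly \<open>p q\<close>
  elements and they are disjoint because \<open>p q\<close> is odd, so every vector lies in exactly two of
  the \<open>B\<^sub>i\<close>.\<close>

section \<open>Orthogonal families as bases\<close>

text \<open>Pairing a vanishing linear combination with one of its vectors leaves a single term, so
  the family is independent, and its size matches the dimension. In a general conjugatable field
  nonzero vectors can be isotropic, hence the condition on \<open>u \<bullet>c u\<close>.\<close>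

lemma orthogonal_basisI:
  fixes S :: "'a::conjugatable_field vec set"
  assumes finS: "finite S" and carr: "S \<subseteq> carrier_vec n" and card: "card S = n"
    and orth: "\<And>u v. u \<in> S \<Longrightarrow> v \<in> S \<Longrightarrow> u \<noteq> v \<Longrightarrow> u \<bullet>c v = 0"
    and nz: "\<And>u. u \<in> S \<Longrightarrow> u \<bullet>c u \<noteq> 0"
  shows "orthogonal_basis n S"
proof -
  interpret vec_space "TYPE('a)" n .
  have "lin_indpt S"
  proof (rule finite_lin_indpt2[OF finS])
    show "S \<subseteq> carrier_vec n"
      by (rule carr)
    fix f :: "'a vec \<Rightarrow> 'a"
    assume zero: "lincomb f S = 0\<^sub>v n"
    show "\<forall>v\<in>S. f v = 0"
    proof
      fix v assume v: "v \<in> S"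
      have cv: "conjugate v \<in> carrier_vec n"
        using v carr by auto
      have "0 = lincomb f S \<bullet>c v"
        using zero cv by simp
      also have "\<dots> = (\<Sum>u\<in>S. (f u \<cdot>\<^sub>v u) \<bullet>c v)"
        unfolding lincomb_def using carr cv by (intro finsum_scalar_prod_sum) auto
      also have "\<dots> = (\<Sum>u\<in>S. if u = v then f v * (v \<bullet>c v) else 0)"
        using carr cv v orth
        by (intro sum.cong refl) (auto simp: smult_scalar_prod_distrib[OF _ cv] subset_iff)
      also have "\<dots> = f v * (v \<bullet>c v)"
        using finS v by simp
      finally show "f v = 0"
        using nz[OF v] by simp
    qed
  qed
  moreover have "fin_dim"
    by (simp add: fin_dim)
  ultimately have "basis S"
    using finS carr card by (intro dim_li_is_basis) (auto simp: dim_is_n)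
  then show ?thesis
    using orth unfolding orthogonal_basis_def by auto
qed

section \<open>Kronecker products of rotations and their complex coordinates\<close>

text \<open>With arbitrary real angles, products, inverses and powers stay in the same two-parameter
  family.\<close>

definition rotation_kron :: "real \<Rightarrow> real \<Rightarrow> real mat" where
  "rotation_kron s t = kronecker_product
     (mat_of_rows_list 2 [[cos s, - sin s], [sin s, cos s]])
     (mat_of_rows_list 2 [[cos t, - sin t], [sin t, cos t]])"

lemma less_4_cases: "(i::nat) < 4 \<longleftrightarrow> i = 0 \<or> i = 1 \<or> i = 2 \<or> i = 3"
  by auto

lemma sum_lessThan_4: "(\<Sum>i<4. f i) = f 0 + f 1 + f 2 + f (3::nat)"
  by (simp add: eval_nat_numeral)

lemma rotation_kron_carrier [simp]: "rotation_kron s t \<in> carrier_mat 4 4"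
  by (auto simp: rotation_kron_def kronecker_product_def mat_of_rows_list_def)

lemma rotation_kron_dims [simp]: "dim_row (rotation_kron s t) = 4" "dim_col (rotation_kron s t) = 4"
  using rotation_kron_carrier[of s t] by (auto simp del: rotation_kron_carrier)

lemma rotation_kron_index:
  assumes "i < 4" "j < 4"
  shows "rotation_kron s t $$ (i, j) =
    [[cos s, - sin s], [sin s, cos s]] ! (i div 2) ! (j div 2) *
    [[cos t, - sin t], [sin t, cos t]] ! (i mod 2) ! (j mod 2)"
  using assms unfolding less_4_cases
  by (auto simp: rotation_kron_def kronecker_product_def mat_of_rows_list_def
      simp flip: numeral_2_eq_2)

lemma rotation_kron_zero: "rotation_kron 0 0 = 1\<^sub>m 4"
  by (rule eq_matI) (auto simp: less_4_cases rotation_kron_index)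

lemma rotation_kron_mult:
  "rotation_kron s t * rotation_kron s' t' = rotation_kron (s + s') (t + t')"
proof (rule eq_matI)
  fix i j
  assume "i < dim_row (rotation_kron (s + s') (t + t'))" "j < dim_col (rotation_kron (s + s') (t + t'))"
  then have ij: "i < 4" "j < 4"
    by simp_all
  then have "(rotation_kron s t * rotation_kron s' t') $$ (i, j) =
      (\<Sum>k<4. rotation_kron s t $$ (i, k) * rotation_kron s' t' $$ (k, j))"
    by (simp add: scalar_prod_def atLeast0LessThan)
  also have "\<dots> = rotation_kron (s + s') (t + t') $$ (i, j)"
    using ij unfolding sum_lessThan_4 less_4_cases
    by (elim disjE) (simp_all add: rotation_kron_index cos_add sin_add algebra_simps)
  finally show "(rotation_kron s t * rotation_kron s' t') $$ (i, j) =
      rotation_kron (s + s') (t + t') $$ (i, j)" .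
qed simp_all

lemma rotation_kron_nat_pow:
  "rotation_kron s t [^]\<^bsub>ring_mat TYPE(real) 4 ()\<^esub> (n::nat) = rotation_kron (n * s) (n * t)"
proof -
  interpret ring "ring_mat TYPE(real) 4 ()"
    by (rule ring_mat)
  show ?thesis
    by (induction n)
      (auto simp: ring_mat_simps rotation_kron_zero rotation_kron_mult algebra_simps)
qed

text \<open>Opposite angles give the inverse, so the exponents \<open>i - 1\<close> and
  \<open>i - r\<close> may be negative.\<close>

lemma rotation_kron_int_pow:
  "mat_int_pow 4 (rotation_kron s t) z = rotation_kron (z * s) (z * t)"
proof -
  interpret ring "ring_mat TYPE(real) 4 ()"
    by (rule ring_mat)
  have "inv\<^bsub>ring_mat TYPE(real) 4 ()\<^esub> (rotation_kron x y) = rotation_kron (- x) (- y)" for x y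
    by (rule inv_char) (simp_all add: ring_mat_simps rotation_kron_mult rotation_kron_zero)
  then show ?thesis
    by (auto simp: int_pow_def2 rotation_kron_nat_pow)
qed

text \<open>The coordinates of the \<open>\<real>\<close>-linear map \<open>z \<mapsto> \<alpha> z + \<beta> cnj z\<close>, read as a
  \<open>2 \<times> 2\<close> matrix row by row.\<close>

definition vec_of_complex_pair :: "complex \<Rightarrow> complex \<Rightarrow> real vec" where
  "vec_of_complex_pair \<alpha> \<beta> = vec_of_list
     [Re \<alpha> + Re \<beta>, Im \<beta> - Im \<alpha>, Im \<alpha> + Im \<beta>, Re \<alpha> - Re \<beta>]"

lemma vec_of_complex_pair_carrier [simp]: "vec_of_complex_pair \<alpha> \<beta> \<in> carrier_vec 4"
  unfolding vec_of_complex_pair_def by (rule carrier_vecI) simp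

lemma vec_of_complex_pair_dim [simp]: "dim_vec (vec_of_complex_pair \<alpha> \<beta>) = 4"
  using vec_of_complex_pair_carrier by (rule carrier_vecD)

lemma vec_of_complex_pair_index:
  "vec_of_complex_pair \<alpha> \<beta> $ 0 = Re \<alpha> + Re \<beta>"
  "vec_of_complex_pair \<alpha> \<beta> $ Suc 0 = Im \<beta> - Im \<alpha>"
  "vec_of_complex_pair \<alpha> \<beta> $ 2 = Im \<alpha> + Im \<beta>"
  "vec_of_complex_pair \<alpha> \<beta> $ 3 = Re \<alpha> - Re \<beta>"
  by (simp_all add: vec_of_complex_pair_def vec_of_list_index eval_nat_numeral)

lemma vec_of_complex_pair_eq_iff:
  "vec_of_complex_pair \<alpha> \<beta> = vec_of_complex_pair \<alpha>' \<beta>' \<longleftrightarrow> \<alpha> = \<alpha>' \<and> \<beta> = \<beta>'"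
proof
  assume "vec_of_complex_pair \<alpha> \<beta> = vec_of_complex_pair \<alpha>' \<beta>'"
  then have "vec_of_complex_pair \<alpha> \<beta> $ i = vec_of_complex_pair \<alpha>' \<beta>' $ i" for i
    by simp
  from this[of 0] this[of "Suc 0"] this[of 2] this[of 3] show "\<alpha> = \<alpha>' \<and> \<beta> = \<beta>'"
    unfolding vec_of_complex_pair_index complex_eq_iff by linarith
qed simp

text \<open>The cross terms between \<alpha> and \<beta> cancel, within the outer two entries and
  within the middle two.\<close>

lemma vec_of_complex_pair_scalar_prod:
  "vec_of_complex_pair \<alpha> \<beta> \<bullet>c vec_of_complex_pair \<alpha>' \<beta>' = 2 * Re (\<alpha> * cnj \<alpha>' + \<beta> * cnj \<beta>')"
  by (simp add: scalar_prod_def atLeast0LessThan sum_lessThan_4 vec_of_complex_pair_index algebra_simps)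

text \<open>On 2 x 2 matrices the Kronecker product acts as X \<mapsto> R_s X R_(-t). Precomposing
  with the rotation by -t multiplies \<alpha> by \<open>cis (- t)\<close> and, through the
  conjugation, \<beta> by \<open>cis t\<close>.\<close>

lemma rotation_kron_mult_vec:
  "rotation_kron s t *\<^sub>v vec_of_complex_pair \<alpha> \<beta> =
   vec_of_complex_pair (cis (s - t) * \<alpha>) (cis (s + t) * \<beta>)"
proof (rule eq_vecI)
  fix i
  assume "i < dim_vec (vec_of_complex_pair (cis (s - t) * \<alpha>) (cis (s + t) * \<beta>))"
  then have i: "i < 4"
    by simp
  then have "(rotation_kron s t *\<^sub>v vec_of_complex_pair \<alpha> \<beta>) $ i =
      (\<Sum>k<4. rotation_kron s t $$ (i, k) * vec_of_complex_pair \<alpha> \<beta> $ k)"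
    by (simp add: scalar_prod_def atLeast0LessThan)
  also have "\<dots> = vec_of_complex_pair (cis (s - t) * \<alpha>) (cis (s + t) * \<beta>) $ i"
    using i unfolding sum_lessThan_4 less_4_cases
    by (elim disjE)
      (simp_all add: rotation_kron_index vec_of_complex_pair_index cos_add sin_add cos_diff sin_diff algebra_simps)
  finally show "(rotation_kron s t *\<^sub>v vec_of_complex_pair \<alpha> \<beta>) $ i =
      vec_of_complex_pair (cis (s - t) * \<alpha>) (cis (s + t) * \<beta>) $ i" .
qed simp

lemma vec_a_eq: "vec_a c \<phi> = vec_of_complex_pair (cis (- \<phi>)) (- c * cis \<phi>)"
  by (simp add: vec_a_def vec_of_complex_pair_def algebra_simps)

lemma vec_b_eq: "vec_b c = vec_of_complex_pair c 1"
  by (simp add: vec_b_def vec_of_complex_pair_def)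

section \<open>Orders of angles and residues\<close>

lemma cis_eq_1_iff_dvd:
  fixes k m d :: int
  assumes "m > 0" "coprime k m"
  shows "cis (d * (2 * pi * k / m)) = 1 \<longleftrightarrow> m dvd d"
proof
  assume "cis (d * (2 * pi * k / m)) = 1"
  then have "cos (d * (2 * pi * k / m)) = 1"
    by (metis cis.sel(1) one_complex.sel(1))
  then obtain n :: int where "d * (2 * pi * k / m) = real_of_int n * 2 * pi"
    unfolding cos_one_2pi_int by blast
  then have "real_of_int (d * k) = real_of_int (n * m)"
    using \<open>m > 0\<close> by (simp add: field_simps)
  then have "d * k = n * m"
    by (simp only: of_int_eq_iff)
  then have "m dvd d * k"
    by simp
  then show "m dvd d"
    using assms(2) by (simp add: coprime_commute coprime_dvd_mult_left_iff)
next
  assume "m dvd d"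
  then obtain n where "d = m * n" ..
  then have "d * (2 * pi * k / m) = 2 * pi * of_int (n * k)"
    using \<open>m > 0\<close> by simp
  then show "cis (d * (2 * pi * k / m)) = 1"
    using cis_multiple_2pi[OF Ints_of_int, of "n * k"] by metis
qed

text \<open>The indices are the residues of \<open>j\<close> and \<open>j + s\<close> modulo
  \<open>n\<close>, distinct because 0 < s < n.\<close>

lemma card_residue_pair:
  fixes n s j :: int
  assumes "0 < s" "s < n" and f: "\<And>i i'. f i = f i' \<longleftrightarrow> n dvd i - i'"
  shows "card {i. i < nat n \<and> (f j = f (int i) \<or> f j = f (int i - s))} = 2"
proof -
  have "{i. i < nat n \<and> (f j = f (int i) \<or> f j = f (int i - s))} =
      {nat (j mod n), nat ((j + s) mod n)}"
  proof -
    have "x = int i mod n \<longleftrightarrow> i = nat x" if "i < nat n" "0 \<le> x" for i x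
      using that by auto
    moreover have "f j = f (int i) \<longleftrightarrow> j mod n = int i mod n"
      "f j = f (int i - s) \<longleftrightarrow> (j + s) mod n = int i mod n" for i
      unfolding f by (auto simp: mod_eq_dvd_iff algebra_simps)
    moreover have "nat (x mod n) < nat n" "0 \<le> x mod n" for x
      using assms by auto
    ultimately show ?thesis
      by blast
  qed
  moreover have "nat (j mod n) \<noteq> nat ((j + s) mod n)"
  proof
    assume "nat (j mod n) = nat ((j + s) mod n)"
    then have "j mod n = (j + s) mod n"
      using assms by (simp add: eq_nat_nat_iff)
    then have "n dvd (j + s) - j"
      by (metis mod_eq_dvd_iff)
    with assms show False
      by (simp add: zdvd_not_zless)
  qed
  ultimately show ?thesis
    by simp
qed

lemma chinese_remainder_one_minus_one:
  fixes p q :: int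
  assumes "p \<ge> 3" "q \<ge> 3" "coprime p q"
  defines "r \<equiv> THE r. 0 < r \<and> r < p * q \<and> [r = 1] (mod p) \<and> [r = - 1] (mod q)"
  shows "0 < r \<and> r < p * q \<and> [r = 1] (mod p) \<and> [r = - 1] (mod q)"
  unfolding r_def
proof (rule theI')
  obtain x where x: "[x = 1] (mod p)" "[x = - 1] (mod q)"
    using binary_chinese_remainder_int[OF assms(3), of 1 "-1"] by blast
  have pq: "p * q > 0"
    using assms by simp
  define y where "y = x mod (p * q)"
  have y: "[y = 1] (mod p)" "[y = - 1] (mod q)"
    using x by (auto simp: y_def cong_def mod_mod_cancel)
  \<comment> \<open>The open interval excludes 0, which is not congruent to 1 modulo
    \<open>p\<close>.\<close>
  have "y \<noteq> 0"
    using y(1) assms by (auto simp: cong_def)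
  moreover have "0 \<le> y" "y < p * q"
    using pq by (simp_all add: y_def)
  moreover have "z = y" if "0 < z" "z < p * q" "[z = 1] (mod p)" "[z = - 1] (mod q)" for z
  proof -
    have "[z = y] (mod p * q)"
      using that y assms(3) by (meson coprime_cong_mult cong_sym cong_trans)
    then show ?thesis
      using that \<open>0 \<le> y\<close> \<open>y < p * q\<close> by (simp add: cong_def)
  qed
  ultimately show "\<exists>!r. 0 < r \<and> r < p * q \<and> [r = 1] (mod p) \<and> [r = - 1] (mod q)"
    using y by (intro ex1I[of _ y]) auto
qed


text \<open>The real factors may be negative, so \<open>- c\<close> needs no change of
  phase.\<close>

lemma vec_of_complex_pair_scalar_prod_polar:
  "vec_of_complex_pair (of_real u * cis x) (of_real v * cis y) \<bullet>c
   vec_of_complex_pair (of_real u' * cis x') (of_real v' * cis y') =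
   2 * (u * u' * cos (x - x') + v * v' * cos (y - y'))"
  unfolding vec_of_complex_pair_scalar_prod by (simp add: cos_diff algebra_simps)

theorem theorem1:
  fixes p q k\<^sub>p k\<^sub>q r :: int and c :: real and a b :: "real vec" and M :: "real mat"
    and B :: "int \<Rightarrow> real vec set" and V :: "real vec set"
  assumes "p \<ge> 3" and "q \<ge> 3" and "odd p" and "odd q" and "coprime p q"
    and "gcd k\<^sub>p p = 1" and "gcd k\<^sub>q q = 1"
    and "c \<noteq> 0"
    and "c\<^sup>2 = - (cos (2 * pi * (of_int k\<^sub>p / of_int p - of_int k\<^sub>q / of_int q))
               / cos (2 * pi * (of_int k\<^sub>p / of_int p + of_int k\<^sub>q / of_int q)))"
    and "a = vec_a c (2 * pi * of_int k\<^sub>q / of_int q)"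
    and "b = vec_b c"
    and "r = (THE r. 0 < r \<and> r < p * q \<and> [r = 1] (mod p) \<and> [r = - 1] (mod q))"
    and "M = kronecker_product (rotation_mat p k\<^sub>p) (rotation_mat q k\<^sub>q)"
    and "B = (\<lambda>i. {mat_int_pow 4 M i *\<^sub>v a, mat_int_pow 4 M (i - 1) *\<^sub>v a,
                   mat_int_pow 4 M i *\<^sub>v b, mat_int_pow 4 M (i - r) *\<^sub>v b})"
    and "V = {mat_int_pow 4 M i *\<^sub>v a | i. 0 \<le> i \<and> i < p * q}
           \<union> {mat_int_pow 4 M i *\<^sub>v b | i. 0 \<le> i \<and> i < p * q}"
  shows "(\<forall>i. 0 \<le> i \<and> i < p * q \<longrightarrow> orthogonal_basis 4 (B i)) \<and>
         kochen_specker_pair 4 V (map B [0..p * q - 1])"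
proof -
  define \<theta> where "\<theta> = 2 * pi * of_int k\<^sub>p / of_int p"
  define \<phi> where "\<phi> = 2 * pi * of_int k\<^sub>q / of_int q"
  define n where "n = p * q"
  have "3 * 3 \<le> p * q"
    using assms(1,2) by (intro mult_mono) auto
  then have n: "n > 1" "odd n"
    using assms(3,4) by (simp_all add: n_def)
  have r: "0 < r" "r < n" "p dvd r - 1" "q dvd r + 1"
    using chinese_remainder_one_minus_one[OF assms(1,2,5)]
    by (simp_all add: assms(12) n_def cong_iff_dvd_diff)

  have cis_\<theta>: "cis (d * \<theta>) = 1 \<longleftrightarrow> p dvd d" for d :: int
    unfolding \<theta>_def using assms(1,6) by (intro cis_eq_1_iff_dvd) (auto simp: coprime_iff_gcd_eq_1)
  have cis_\<phi>: "cis (d * \<phi>) = 1 \<longleftrightarrow> q dvd d" for d :: int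
    unfolding \<phi>_def using assms(2,7) by (intro cis_eq_1_iff_dvd) (auto simp: coprime_iff_gcd_eq_1)
  have trig_\<theta>: "sin (d * \<theta>) = 0" "cos (d * \<theta>) = 1" if "p dvd d" for d :: int
    using that cis_\<theta>[of d] by (simp_all add: complex_eq_iff)
  have trig_\<phi>: "sin (d * \<phi>) = 0" "cos (d * \<phi>) = 1" if "q dvd d" for d :: int
    using that cis_\<phi>[of d] by (simp_all add: complex_eq_iff)

  \<comment> \<open>The two orbits: period and disjointness\<close>
  define X where "X i = mat_int_pow 4 M i *\<^sub>v a" for i
  define Y where "Y i = mat_int_pow 4 M i *\<^sub>v b" for i
  have M: "M = rotation_kron \<theta> \<phi>"
    by (simp add: assms(13) rotation_kron_def rotation_mat_def \<theta>_def \<phi>_def)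
  \<comment> \<open>The extra multiple of \<phi> comes from the phases -\<phi> and \<phi> of
    \<open>a\<close> itself. The factor \<open>of_real 1\<close> fits the polar form of the scalar
    product.\<close>
  have X: "X i = vec_of_complex_pair (of_real 1 * cis (i * \<theta> - (i + 1) * \<phi>))
      (of_real (- c) * cis (i * \<theta> + (i + 1) * \<phi>))" for i
  proof -
    have arg: "cis (i * \<theta> - (of_int i + 1) * \<phi>) = cis (i * \<theta> - i * \<phi>) * cis (- \<phi>)"
      "cis (i * \<theta> + (of_int i + 1) * \<phi>) = cis (i * \<theta> + i * \<phi>) * cis \<phi>"
      unfolding cis_mult by (simp_all add: algebra_simps)
    show ?thesis
      unfolding X_def M assms(10) vec_a_eq rotation_kron_int_pow rotation_kron_mult_vec
        \<phi>_def[symmetric]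
      by (simp add: arg mult.left_commute)
  qed
  have Y: "Y i = vec_of_complex_pair (of_real c * cis (i * \<theta> - i * \<phi>))
      (of_real 1 * cis (i * \<theta> + i * \<phi>))" for i
    by (simp add: Y_def M assms(11) vec_b_eq rotation_kron_int_pow rotation_kron_mult_vec
        mult.commute[of _ "complex_of_real c"])
  have carrier: "X i \<in> carrier_vec 4" "Y i \<in> carrier_vec 4" for i
    by (simp_all add: X Y)

  \<comment> \<open>The offset \<open>e\<close> is 1 for \<open>X\<close> and 0 for
    \<open>Y\<close>.\<close>
  have cis_eq: "cis (i * \<theta> - (i + e) * \<phi>) = cis (j * \<theta> - (j + e) * \<phi>) \<and>
      cis (i * \<theta> + (i + e) * \<phi>) = cis (j * \<theta> + (j + e) * \<phi>) \<longleftrightarrow> n dvd i - j" for i j e :: int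
  proof -
    define d where "d = i - j"
    have "cis x = cis y \<longleftrightarrow> cis (x - y) = 1" for x y
      by (simp flip: cis_divide)
    then have "cis (i * \<theta> - (i + e) * \<phi>) = cis (j * \<theta> - (j + e) * \<phi>) \<and>
        cis (i * \<theta> + (i + e) * \<phi>) = cis (j * \<theta> + (j + e) * \<phi>) \<longleftrightarrow>
        cis (d * \<theta> - d * \<phi>) = 1 \<and> cis (d * \<theta> + d * \<phi>) = 1"
      by (simp add: d_def algebra_simps)
    also have "\<dots> \<longleftrightarrow> n dvd d"
    proof
      assume *: "cis (d * \<theta> - d * \<phi>) = 1 \<and> cis (d * \<theta> + d * \<phi>) = 1"
      \<comment> \<open>Product and quotient of the two phases separate \<theta> from \<phi> at the
        cost of a factor 2, which is harmless for odd \<open>p\<close> and \<open>q\<close>.\<close>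
      have "cis ((2 * d) * \<theta>) = cis (d * \<theta> - d * \<phi>) * cis (d * \<theta> + d * \<phi>)"
        by (simp add: cis_mult algebra_simps)
      then have "cis (of_int (2 * d) * \<theta>) = 1"
        using * by simp
      then have "p dvd 2 * d"
        unfolding cis_\<theta> .
      moreover have "cis ((2 * d) * \<phi>) = cis (d * \<theta> + d * \<phi>) / cis (d * \<theta> - d * \<phi>)"
        by (simp add: cis_divide algebra_simps)
      then have "cis (of_int (2 * d) * \<phi>) = 1"
        using * by simp
      then have "q dvd 2 * d"
        unfolding cis_\<phi> .
      ultimately have "p dvd d" "q dvd d"
        using assms(3,4) by (simp_all add: coprime_dvd_mult_right_iff)
      then show "n dvd d"
        using assms(5) by (simp add: n_def divides_mult)
    next
      assume "n dvd d"
      then have "p dvd d" "q dvd d"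
        unfolding n_def using dvd_mult_left dvd_mult_right by blast+
      then have "cis (d * \<theta>) = 1" "cis (d * \<phi>) = 1"
        by (simp_all add: cis_\<theta> cis_\<phi>)
      then show "cis (d * \<theta> - d * \<phi>) = 1 \<and> cis (d * \<theta> + d * \<phi>) = 1"
        by (simp flip: cis_divide cis_mult)
    qed
    finally show ?thesis
      by (simp add: d_def)
  qed
  have X_eq: "X i = X j \<longleftrightarrow> n dvd i - j" for i j
    using cis_eq[of i 1 j] assms(8) by (simp add: X vec_of_complex_pair_eq_iff)
  have Y_eq: "Y i = Y j \<longleftrightarrow> n dvd i - j" for i j
    using cis_eq[of i 0 j] assms(8) by (simp add: Y vec_of_complex_pair_eq_iff)

  have X_neq_Y: "X i \<noteq> Y j" for i j
  \<comment> \<open>Comparing \<open>n\<close>-th powers of both components gives \<open>1 = c\<^sup>n\<close> and \<open>(- c)\<^sup>n = 1\<close>, where \<open>n\<close> is odd.\<close>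
  proof
    assume "X i = Y j"
    then have eq: "cis (i * \<theta> - (i + 1) * \<phi>) = of_real c * cis (j * \<theta> - j * \<phi>)"
      "of_real (- c) * cis (i * \<theta> + (i + 1) * \<phi>) = cis (j * \<theta> + j * \<phi>)"
      by (simp_all add: X Y vec_of_complex_pair_eq_iff)
    have root: "cis (u * \<theta> + v * \<phi>) ^ nat n = 1" for u v :: int
    proof -
      have "cis (u * \<theta> + v * \<phi>) ^ nat n = cis (of_int (n * u) * \<theta>) * cis (of_int (n * v) * \<phi>)"
        unfolding Complex.DeMoivre cis_mult using n by (simp add: algebra_simps)
      moreover have "p dvd n * u" "q dvd n * v"
        by (simp_all add: n_def)
      ultimately show ?thesis
        using cis_\<theta>[of "n * u"] cis_\<phi>[of "n * v"] by simp
    qed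
    have root': "cis (u * \<theta> - v * \<phi>) ^ nat n = 1" for u v :: int
      using root[of u "- v"] by simp
    have "odd (nat n)"
      using n by (simp add: even_nat_iff)
    have "complex_of_real c ^ nat n = 1"
      using arg_cong[OF eq(1), of "\<lambda>z. z ^ nat n"] root'[of i "i + 1"] root'[of j j]
      by (simp add: power_mult_distrib)
    moreover have "- (complex_of_real c ^ nat n) = 1"
      using arg_cong[OF eq(2), of "\<lambda>z. z ^ nat n"] root[of i "i + 1"] root[of j j] \<open>odd (nat n)\<close>
      by (simp add: power_mult_distrib)
    ultimately show False
      by simp
  qed

  \<comment> \<open>Scalar products and bases\<close>
  have "cos (\<theta> - \<phi>) + c\<^sup>2 * cos (\<theta> + \<phi>) = 0"
  proof -
    have arg: "2 * pi * (of_int k\<^sub>p / of_int p - of_int k\<^sub>q / of_int q) = \<theta> - \<phi>"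
      "2 * pi * (of_int k\<^sub>p / of_int p + of_int k\<^sub>q / of_int q) = \<theta> + \<phi>"
      by (simp_all add: \<theta>_def \<phi>_def algebra_simps)
    \<comment> \<open>Division by zero yields 0, so a vanishing denominator would force
      \<open>c = 0\<close>.\<close>
    have "cos (\<theta> + \<phi>) \<noteq> 0"
      using assms(8,9) unfolding arg by auto
    then show ?thesis
      using assms(9) unfolding arg by (simp add: field_simps)
  qed
  note c = this
  have XX: "X i \<bullet>c X (i - 1) = 0" for i
    unfolding X vec_of_complex_pair_scalar_prod_polar using c
    by (simp add: algebra_simps power2_eq_square)
  have YY: "Y i \<bullet>c Y (i - r) = 0" for i
  proof -
    \<comment> \<open>Modulo 2 pi, multiplication by \<open>r\<close> fixes \<theta> and negates
      \<phi>. This swaps the two cosines, just as \<open>b\<close> swaps the weights 1 and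
      \<open>c\<^sup>2\<close>.\<close>
    have shift: "r * \<theta> = \<theta> + of_int (r - 1) * \<theta>" "r * \<phi> = - \<phi> + of_int (r + 1) * \<phi>"
      by (simp_all add: algebra_simps)
    have "cos (r * \<theta>) = cos \<theta>" "sin (r * \<theta>) = sin \<theta>"
      unfolding shift cos_add sin_add using trig_\<theta>[OF r(3)] by simp_all
    moreover have "cos (r * \<phi>) = cos \<phi>" "sin (r * \<phi>) = - sin \<phi>"
      unfolding shift cos_add sin_add using trig_\<phi>[OF r(4)] by simp_all
    ultimately have "cos (r * \<theta> - r * \<phi>) = cos (\<theta> + \<phi>)" "cos (r * \<theta> + r * \<phi>) = cos (\<theta> - \<phi>)"
      unfolding cos_add cos_diff by simp_all
    then show ?thesis
      unfolding Y vec_of_complex_pair_scalar_prod_polar using c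
      by (simp add: algebra_simps power2_eq_square)
  qed
  have XY: "X i \<bullet>c Y j = 0" if "p dvd i - j \<or> q dvd i - j + 1" for i j
  proof -
    define d where "d = i - j"
    \<comment> \<open>The scalar product is 2c times the difference of these cosines, that is 4c
      sin(d \<theta>) sin((d + 1) \<phi>).\<close>
    have "cos (d * \<theta> - (d + 1) * \<phi>) = cos (d * \<theta> + (d + 1) * \<phi>)"
      unfolding cos_add cos_diff
      using that trig_\<theta>(1)[of d] trig_\<phi>(1)[of "d + 1"] by (auto simp: d_def)
    then show ?thesis
      unfolding X Y vec_of_complex_pair_scalar_prod_polar
      by (simp add: d_def algebra_simps)
  qed
  have norm: "X i \<bullet>c X i \<noteq> 0" "Y i \<bullet>c Y i \<noteq> 0" for i
    unfolding X Y vec_of_complex_pair_scalar_prod_polar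
    using sum_power2_gt_zero_iff[of 1 c] by (auto simp: power2_eq_square)

  have B: "B i = {X i, X (i - 1), Y i, Y (i - r)}" for i
    by (simp add: assms(14) X_def Y_def)
  have V: "V = {X i | i. 0 \<le> i \<and> i < n} \<union> {Y i | i. 0 \<le> i \<and> i < n}"
    by (simp add: assms(15) X_def Y_def n_def)
  have basis: "orthogonal_basis 4 (B i)" for i
  proof (rule orthogonal_basisI)
    have "\<not> n dvd 1" "\<not> n dvd r"
      using n r by (auto simp: zdvd_not_zless)
    then have "X i \<noteq> X (i - 1)" "Y i \<noteq> Y (i - r)"
      by (simp_all add: X_eq Y_eq)
    then show "card (B i) = 4"
      using X_neq_Y X_neq_Y[symmetric] by (simp add: B)
  next
    \<comment> \<open>The mixed pairs have index differences 0, r, -1 and r - 1, each covered by one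
      of the two divisibility conditions.\<close>
    have orth: "X i \<bullet>c X (i - 1) = 0" "Y i \<bullet>c Y (i - r) = 0"
      "X i \<bullet>c Y i = 0" "X i \<bullet>c Y (i - r) = 0" "X (i - 1) \<bullet>c Y i = 0" "X (i - 1) \<bullet>c Y (i - r) = 0"
      using r XX YY XY[of i i] XY[of i "i - r"] XY[of "i - 1" i] XY[of "i - 1" "i - r"]
      by (simp_all add: algebra_simps)
    have swap: "v \<bullet>c u = 0"
      if "u \<in> carrier_vec 4" "v \<in> carrier_vec 4" "u \<bullet>c v = 0" for u v :: "real vec"
      using that by (simp add: comm_scalar_prod[of v 4 u])
    note orth' = swap[OF carrier(1) carrier(1) orth(1)] swap[OF carrier(2) carrier(2) orth(2)]
      orth(3-6)[THEN swap[OF carrier(1) carrier(2)]]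
    show "u \<bullet>c v = 0" if "u \<in> B i" "v \<in> B i" "u \<noteq> v" for u v
      using that orth orth' unfolding B by auto
  qed (use carrier norm in \<open>auto simp: B\<close>)

  \<comment> \<open>Incidence count\<close>
  \<comment> \<open>\<open>B i\<close> can involve negative exponents; periodicity moves them into
    the range used for \<open>V\<close>.\<close>
  have in_V: "X i \<in> V" "Y i \<in> V" for i
  proof -
    have "n dvd i - i mod n"
      by (simp add: minus_mod_eq_mult_div)
    then have "X i = X (i mod n)" "Y i = Y (i mod n)"
      by (simp_all add: X_eq Y_eq)
    then show "X i \<in> V" "Y i \<in> V"
      using n unfolding V by auto
  qed
  have "finite V"
    unfolding V by (auto simp: setcompr_eq_image intro!: finite_imageI)
  moreover have "V \<subseteq> carrier_vec 4"
    using carrier by (auto simp: V)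
  moreover have "odd (length (map B [0..n - 1]))"
    using n by (simp add: even_nat_iff)
  moreover have "even (card {i. i < length (map B [0..n - 1]) \<and> v \<in> map B [0..n - 1] ! i})"
    if "v \<in> V" for v
  proof -
    have set: "{i. i < length (map B [0..n - 1]) \<and> v \<in> map B [0..n - 1] ! i} =
        {i. i < nat n \<and> v \<in> B (int i)}"
      by auto
    from that consider j where "v = X j" | j where "v = Y j"
      unfolding V by blast
    \<comment> \<open>By disjointness only the two members of \<open>B i\<close> from the orbit of
      \<open>v\<close> matter; their exponents differ by 1 for \<open>a\<close> and by
      \<open>r\<close> for \<open>b\<close>.\<close>
    then have "card {i. i < nat n \<and> v \<in> B (int i)} = 2"
    proof cases
      case 1
      then show ?thesis
        using card_residue_pair[of 1 n X j] n X_eq X_neq_Y by (simp add: B)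
    next
      case 2
      then show ?thesis
        using card_residue_pair[of r n Y j] r Y_eq X_neq_Y[symmetric] by (simp add: B)
    qed
    then show ?thesis
      unfolding set by simp
  qed
  ultimately have "kochen_specker_pair 4 V (map B [0..n - 1])"
    unfolding kochen_specker_pair_def using basis in_V by (auto simp: B)
  then show ?thesis
    using basis by (simp add: n_def)
qed

end
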